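(* Let $\operatorname{Gc}$ be an acceptable code. Then for every $n\ge1$ and every composition $I=(i_1,\ldots,i_r)$ of $n$, with $D_I$ the set of $\sigma\in\mathfrak S_n$ whose descent set equals $\{i_1,i_1+i_2,\ldots,i_1+\cdots+i_{r-1}\}$, $$\sum_{\sigma\in D_I} x_{\operatorname{Gc}(\sigma^{-1})}=\sum_{\sigma\in D_I} x_{\operatorname{Ic}(\sigma^{-1})}=r_I(\mathbf X_I).$$ In other words, the nondecreasing rearrangements of $\operatorname{Gc}(\sigma^{-1})$ and $\operatorname{Ic}(\sigma^{-1})$ have the same distribution on $D_I$.
   Context: Permutations are words $\sigma=\sigma(1)\cdots\sigma(n)$; descent set of $\sigma$ is $\{j:\sigma(j)>\sigma(j+1)\}$. A sequence $(a_1,\ldots,a_n)$ is sub-diagonal if $0\le a_i\le n-i$ for all $i$. A code is a family of bijections $\operatorname{Gc}$ from $\mathfrak S_n$ to the set of sub-diagonal sequences of length $n$, for every $n$. For $\beta\in\mathfrak S_n$ and $0\le i\le n$, $1\Cup_i\beta\in\mathfrak S_{n+1}$ is the permutation obtained from $\beta$ by adding $1$ to every letter and inserting the letter $1$ at position $i+1$. A code is compatible with the shuffle if for every $\beta\in\mathfrak S_n$ and $0\le i\le n$, $\operatorname{Gc}(1\Cup_i\beta)=(t,\operatorname{Gc}(\beta))$ for some integer $t$; then $\tau_G(\beta)$ is the map $\{0,\ldots,n\}\to\{0,\ldots,n\}$ sending $i$ to the first entry of $\operatorname{Gc}(1\Cup_i\beta)$ (a permutation of $\{0,\ldots,n\}$).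 A code compatible with the shuffle is acceptable if for all $n$, all $\beta\in\mathfrak S_n$ and all $k\in[0,n]$, setting $\beta'=1\Cup_k\beta$, one has $\{\tau_G(\beta')(i): i\in[0,k]\}=\{\tau_G(\beta)(i): i\in[0,k]\}$. $x_0,x_1,\ldots$ are commuting indeterminates, $x_c=x_{c_1}\cdots x_{c_n}$, $X_m=\{x_0,\ldots,x_m\}$, $h_k(X_m)$ the complete homogeneous symmetric polynomial of degree $k$ in $X_m$. Invcode: $\operatorname{Ic}(\sigma)$ has $i$-th entry the number of values greater than $i$ to the left of $i$ in $\sigma$. With $s_q=i_1+\cdots+i_q$, $r_I(\mathbf X_I)=\det M$ where $M$ is $r\times r$ with $M_{p,q}=h_{i_p+\cdots+i_q}(X_{n-s_q})$ for $q\ge p$, $M_{q+1,q}=1$, and $M_{p,q}=0$ for $p>q+1$. *)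

theory Defs
  imports
    "HOL-Library.Multiset"
    "HOL-Library.Poly_Mapping"
    "HOL-Combinatorics.Multiset_Permutations"
    "Jordan_Normal_Form.Determinant"
begin

text \<open>
  Permutations are words on the letters \<open>1, \<dots>, n\<close>. Lists are indexed from \<open>0\<close>, so
  the letter \<open>\<sigma>(j)\<close> is \<open>\<sigma> ! (j - 1)\<close>. Positions, letters and descents keep
  their usual 1-based values.
\<close>

definition perms :: "nat \<Rightarrow> nat list set" where
  "perms n = permutations_of_set {1..n}"

definition word_inverse :: "nat list \<Rightarrow> nat list" where
  "word_inverse \<sigma> =
     map (\<lambda>v. Suc (inv_into {..<length \<sigma>} (\<lambda>j. \<sigma> ! j) v)) [1..<Suc (length \<sigma>)]"

definition descent_set :: "nat list \<Rightarrow> nat set" where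
  "descent_set \<sigma> = {j. 1 \<le> j \<and> j < length \<sigma> \<and> \<sigma> ! (j - 1) > \<sigma> ! j}"

definition composition_of :: "nat list \<Rightarrow> nat \<Rightarrow> bool" where
  "composition_of I n \<longleftrightarrow> (\<forall>i\<in>set I. i \<ge> 1) \<and> sum_list I = n"

definition partial_sum :: "nat list \<Rightarrow> nat \<Rightarrow> nat" where
  "partial_sum I q = sum_list (take q I)"

definition descent_class :: "nat list \<Rightarrow> nat list set" where
  "descent_class I =
     {\<sigma> \<in> perms (sum_list I). descent_set \<sigma> = {partial_sum I q | q. 1 \<le> q \<and> q < length I}}"

definition subdiagonal :: "nat \<Rightarrow> nat list set" where
  "subdiagonal n = {a. length a = n \<and> (\<forall>i\<in>{1..n}. a ! (i - 1) \<le> n - i)}"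

text \<open>
  The length of a word determines \<open>n\<close>, so a family of maps indexed by \<open>n\<close> is a single
  function on lists. The case \<open>n = 0\<close> (empty word, empty sequence) is included in all the
  following conditions; it matters for acceptability, where it forces
  \<open>Gc [1, 2] = [0, 0]\<close>.
\<close>

definition is_code :: "(nat list \<Rightarrow> nat list) \<Rightarrow> bool" where
  "is_code Gc \<longleftrightarrow> (\<forall>n. bij_betw Gc (perms n) (subdiagonal n))"

definition insert_one :: "nat \<Rightarrow> nat list \<Rightarrow> nat list" where
  "insert_one i \<beta> = map Suc (take i \<beta>) @ [1] @ map Suc (drop i \<beta>)"

definition shuffle_compatible :: "(nat list \<Rightarrow> nat list) \<Rightarrow> bool" where
  "shuffle_compatible Gc \<longleftrightarrow>
     (\<forall>n. \<forall>\<beta>\<in>perms n. \<forall>i\<in>{0..n}. \<exists>t. Gc (insert_one i \<beta>) = t # Gc \<beta>)"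

definition code_tau :: "(nat list \<Rightarrow> nat list) \<Rightarrow> nat list \<Rightarrow> nat \<Rightarrow> nat" where
  "code_tau Gc \<beta> i = hd (Gc (insert_one i \<beta>))"

definition acceptable_code :: "(nat list \<Rightarrow> nat list) \<Rightarrow> bool" where
  "acceptable_code Gc \<longleftrightarrow>
     is_code Gc \<and> shuffle_compatible Gc \<and>
     (\<forall>n. \<forall>\<beta>\<in>perms n. \<forall>k\<in>{0..n}.
        code_tau Gc (insert_one k \<beta>) ` {0..k} = code_tau Gc \<beta> ` {0..k})"

definition invcode :: "nat list \<Rightarrow> nat list" where
  "invcode \<sigma> =
     map (\<lambda>i. length (filter (\<lambda>v. v > i) (takeWhile (\<lambda>v. v \<noteq> i) \<sigma>))) [1..<Suc (length \<sigma>)]"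

text \<open>
  Polynomials with integer coefficients in the indeterminates \<open>x\<^sub>0, x\<^sub>1, \<dots>\<close>: a monomial is
  a finitely supported map from indices to exponents.
\<close>

type_synonym xpoly = "(nat \<Rightarrow>\<^sub>0 nat) \<Rightarrow>\<^sub>0 int"

definition xvar :: "nat \<Rightarrow> xpoly" where
  "xvar i = Poly_Mapping.single (Poly_Mapping.single i 1) 1"

definition xmonom :: "nat list \<Rightarrow> xpoly" where
  "xmonom c = prod_list (map xvar c)"

text \<open>\<open>complete_hom k m\<close> is \<open>h\<^sub>k\<close> in the \<open>m + 1\<close> variables \<open>x\<^sub>0, \<dots>, x\<^sub>m\<close>.\<close>

definition complete_hom :: "nat \<Rightarrow> nat \<Rightarrow> xpoly" where
  "complete_hom k m = (\<Sum>A\<in>multisets_of_size {0..m} k. \<Prod>i\<in>#A. xvar i)"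

text \<open>
  Rows and columns are numbered from \<open>0\<close>: entry \<open>(p, q)\<close> below is the entry in row
  \<open>p + 1\<close> and column \<open>q + 1\<close> in the usual numbering, where the parts involved are
  \<open>i\<^sub>p\<^sub>+\<^sub>1, \<dots>, i\<^sub>q\<^sub>+\<^sub>1\<close>, that is \<open>I ! p, \<dots>, I ! q\<close>.
\<close>

definition ribbon_matrix :: "nat list \<Rightarrow> xpoly mat" where
  "ribbon_matrix I =
     mat (length I) (length I) (\<lambda>(p, q).
       if p \<le> q then complete_hom (\<Sum>j=p..q. I ! j) (sum_list I - partial_sum I (Suc q))
       else if p = Suc q then 1
       else 0)"

definition ribbon_poly :: "nat list \<Rightarrow> xpoly" where
  "ribbon_poly I = det (ribbon_matrix I)"

end

theory Submission
  imports Defs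
begin

text \<open>
  Every permutation \<open>\<tau>\<close> arises in a unique way by successive insertions of \<open>1\<close>, and the
  insertion positions, read from the last insertion to the first, form the invcode of \<open>\<tau>\<close>. The
  descents of \<open>\<tau>\<^sup>-\<^sup>1\<close> are exactly the descents of this sequence, so a descent class corresponds to
  the sub-diagonal sequences with prescribed descents, and shuffling \<open>1 2 \<dots> a\<close> into \<open>\<beta>\<close> amounts
  to prefixing a nondecreasing sequence of length \<open>a\<close>. For an acceptable code, the entries
  contributed by such prefixes with values at most \<open>j\<close> sum up to \<open>h\<^sub>a\<close> in the variables
  indexed by \<open>\<tau>\<^sub>G(\<beta>)({0,\<dots>,j})\<close>; acceptability is what makes the induction on \<open>a\<close> work. For
  \<open>j = m\<close>, the length of \<open>\<beta>\<close>, the result \<open>h\<^sub>a(X\<^sub>m)\<close> no longer depends on the code. Hence the sums over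
  descent classes satisfy
  \<open>r(a, b, J) + r(a + b, J) = h\<^sub>a(X\<^sub>m) r(b, J)\<close> with \<open>m = b + |J|\<close>, which is
  the expansion of the determinant along its first column.
\<close>

section \<open>Descents and compositions\<close>

lemma descent_set_short [simp]: "descent_set [] = {}" "descent_set [x] = {}"
  by (auto simp: descent_set_def)

lemma descent_set_Cons2 [simp]:
  "descent_set (x # y # l) = (if y < x then {1} else {}) \<union> Suc ` descent_set (y # l)"
proof (rule Set.set_eqI)
  fix j
  show "j \<in> descent_set (x # y # l) \<longleftrightarrow>
      j \<in> (if y < x then {1} else {}) \<union> Suc ` descent_set (y # l)"
  proof (cases j)
    case 0
    then show ?thesis by (auto simp: descent_set_def)
  next
    case (Suc i)
    then show ?thesis
      by (cases i) (auto simp: descent_set_def image_iff)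
  qed
qed

lemma descent_set_map_strict_mono:
  assumes "strict_mono f"
  shows "descent_set (map f l) = descent_set l"
  using assms by (auto simp: descent_set_def strict_mono_less)

lemma descent_set_bounds: "j \<in> descent_set l \<Longrightarrow> 1 \<le> j \<and> j < length l"
  by (simp add: descent_set_def)

lemma sorted_iff_descent_set_empty: "sorted l \<longleftrightarrow> descent_set l = {}"
proof (induction l)
  case (Cons x l)
  then show ?case by (cases l) auto
qed simp

text \<open>The junction at position \<open>length d\<close> is a descent or not according to the
  last letter of \<open>d\<close> and the first of \<open>c\<close>. Removing it leaves only the
  descents inside the two factors.\<close>

lemma descent_set_append:
  assumes "c \<noteq> []"
  shows "descent_set (d @ c) - {length d} = descent_set d \<union> (+) (length d) ` descent_set c"
proof (induction d)
  case Nil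
  then show ?case using descent_set_bounds[of 0 c] by auto
next
  case (Cons x d)
  have *: "Suc ` (S - {k}) = Suc ` S - {Suc k}" for S and k :: nat
    by auto
  show ?case
  proof (cases d)
    case Nil
    obtain y c' where "c = y # c'" using assms by (cases c) auto
    then show ?thesis using Nil descent_set_bounds[of 0 c] by auto
  next
    case (Cons y d')
    have "descent_set ((x # d) @ c) - {length (x # d)} =
        (if y < x then {1} else {}) \<union> Suc ` (descent_set (d @ c) - {length d})"
      unfolding * using Cons by auto
    then show ?thesis
      unfolding Cons.IH using Cons by (auto simp: image_iff)
  qed
qed

section \<open>Descent sets prescribed by compositions\<close>

definition cut_points :: "nat list \<Rightarrow> nat set" where
  "cut_points I = {partial_sum I q | q. 1 \<le> q \<and> q < length I}"

lemma cut_points_singleton [simp]: "cut_points [a] = {}"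
  by (auto simp: cut_points_def)

lemma cut_points_Cons:
  assumes "J \<noteq> []"
  shows "cut_points (a # J) = insert a ((+) a ` cut_points J)"
proof (intro equalityI subsetI)
  fix x assume "x \<in> cut_points (a # J)"
  then obtain q where q: "x = partial_sum (a # J) q" "1 \<le> q" "q < Suc (length J)"
    by (auto simp: cut_points_def)
  obtain p where p: "q = Suc p" using q by (cases q) auto
  show "x \<in> insert a ((+) a ` cut_points J)"
    using q p by (cases p) (auto simp: cut_points_def partial_sum_def)
next
  fix x assume "x \<in> insert a ((+) a ` cut_points J)"
  then consider "x = a" | q where "x = a + partial_sum J q" "1 \<le> q" "q < length J"
    by (auto simp: cut_points_def)
  then show "x \<in> cut_points (a # J)"
  proof cases
    case 1
    then show ?thesis using assms
      by (auto simp: cut_points_def partial_sum_def intro!: exI[of _ 1])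
  next
    case 2
    then show ?thesis
      by (auto simp: cut_points_def partial_sum_def intro!: exI[of _ "Suc q"])
  qed
qed

text \<open>Merging the first two parts removes the cut at \<open>a\<close> and no other: compare
  \<open>cut_points_Cons\<close> for \<open>a # b # J\<close>.\<close>

lemma cut_points_merge: "cut_points ((a + b) # J) = (+) a ` cut_points (b # J)"
proof (cases "J = []")
  case False
  then show ?thesis by (auto simp: cut_points_Cons image_iff add.assoc)
qed simp

lemma cut_points_positive: "\<forall>i\<in>set I. 1 \<le> i \<Longrightarrow> 0 \<notin> cut_points I"
proof (induction I)
  case (Cons a I)
  then show ?case by (cases "I = []") (auto simp: cut_points_Cons)
qed (simp add: cut_points_def)

section \<open>Sub-diagonal sequences and insertions of 1\<close>

lemma subdiagonal_0 [simp]: "subdiagonal 0 = {[]}"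
  by (auto simp: subdiagonal_def)

lemma subdiagonal_length: "c \<in> subdiagonal n \<Longrightarrow> length c = n"
  by (simp add: subdiagonal_def)

text \<open>The bound on an entry depends only on its distance from the end, so a new head leaves
  the other bounds unchanged. This allows recursion on the sequence.\<close>

lemma Cons_subdiagonal_iff [simp]:
  "k # c \<in> subdiagonal (Suc n) \<longleftrightarrow> k \<le> n \<and> c \<in> subdiagonal n"
proof
  assume *: "k # c \<in> subdiagonal (Suc n)"
  have "c ! (i - 1) \<le> n - i" if "i \<in> {1..n}" for i
  proof -
    have "(k # c) ! (Suc i - 1) \<le> Suc n - Suc i"
      using * that unfolding subdiagonal_def by fastforce
    then show ?thesis using that by (simp add: nth_Cons split: nat.splits)
  qed
  moreover have "(k # c) ! (1 - 1) \<le> Suc n - 1"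
    using * unfolding subdiagonal_def by fastforce
  ultimately show "k \<le> n \<and> c \<in> subdiagonal n"
    using * by (auto simp: subdiagonal_def)
next
  assume *: "k \<le> n \<and> c \<in> subdiagonal n"
  have "(k # c) ! (i - 1) \<le> Suc n - i" if "i \<in> {1..Suc n}" for i
  proof (cases "i = 1")
    case False
    then have "i - 1 \<in> {1..n}" using that by auto
    then have "c ! (i - 1 - 1) \<le> n - (i - 1)"
      using * unfolding subdiagonal_def by blast
    moreover have "i - 1 = Suc (i - 2)" using False that by auto
    ultimately show ?thesis using that by (simp add: numeral_2_eq_2)
  qed (use * in simp)
  then show "k # c \<in> subdiagonal (Suc n)"
    using * by (auto simp: subdiagonal_def)
qed

lemma subdiagonal_SucE:
  assumes "c \<in> subdiagonal (Suc n)"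
  obtains k d where "c = k # d" "k \<le> n" "d \<in> subdiagonal n"
  using assms by (cases c) (auto dest: subdiagonal_length)

lemma subdiagonal_append:
  assumes "c \<in> subdiagonal m" "set d \<subseteq> {0..m}"
  shows "d @ c \<in> subdiagonal (length d + m)"
  using assms(2) by (induction d) (use assms(1) in auto)

text \<open>The last entry of \<open>d\<close> is at most \<open>m\<close> by sub-diagonality, and
  monotonicity carries this bound back to all earlier entries.\<close>

lemma subdiagonal_append_sortedD:
  assumes "d @ c \<in> subdiagonal (length d + m)" "sorted d"
  shows "c \<in> subdiagonal m" "set d \<subseteq> {0..m}"
  using assms
proof (induction d)
  case (Cons x d)
  { case 1 then show ?case using Cons by simp }
  { case 2 then show ?case using Cons by (cases d) auto }
qed auto

lemma finite_subdiagonal [simp]: "finite (subdiagonal n)"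
proof (induction n)
  case (Suc n)
  have "subdiagonal (Suc n) \<subseteq> (\<lambda>(k, c). k # c) ` ({..n} \<times> subdiagonal n)"
    by (force elim: subdiagonal_SucE)
  then show ?case using Suc by (auto intro: finite_subset)
qed simp

section \<open>Permutations built by repeated insertion of 1\<close>

lemma perms_iff: "\<sigma> \<in> perms n \<longleftrightarrow> set \<sigma> = {1..n} \<and> distinct \<sigma>"
  by (auto simp: perms_def permutations_of_set_def)

lemma perms_length: "\<sigma> \<in> perms n \<Longrightarrow> length \<sigma> = n"
  using distinct_card[of \<sigma>] by (simp add: perms_iff)

lemma insert_one_perms:
  assumes "\<beta> \<in> perms n"
  shows "insert_one k \<beta> \<in> perms (Suc n)"
proof -
  have "set (insert_one k \<beta>) = insert 1 (Suc ` set (take k \<beta> @ drop k \<beta>))"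
    unfolding insert_one_def set_append by auto
  also have "\<dots> = insert 1 (Suc ` {1..n})"
    using assms by (simp add: perms_iff del: set_append)
  also have "\<dots> = {1..Suc n}"
    by (auto simp: image_Suc_atLeastAtMost)
  finally have "set (insert_one k \<beta>) = {1..Suc n}" .
  moreover have "distinct (insert_one k \<beta>)"
    using assms set_take_disj_set_drop_if_distinct[of \<beta> k k]
    by (auto simp: insert_one_def perms_iff distinct_map dest: in_set_takeD in_set_dropD)
  ultimately show ?thesis by (simp add: perms_iff)
qed

text \<open>Deleting the letter 1 and lowering all others by one gives \<open>\<beta>\<close>; the
  number of letters in front of 1 is \<open>k\<close>.\<close>

lemma perms_SucE:
  assumes "\<tau> \<in> perms (Suc n)"
  obtains k \<beta> where "k \<le> n" "\<beta> \<in> perms n" "\<tau> = insert_one k \<beta>"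
proof -
  have "1 \<in> set \<tau>" using assms by (simp add: perms_iff)
  then obtain A B where AB: "\<tau> = A @ 1 # B" by (meson split_list)
  have dist: "distinct (A @ B)" "1 \<notin> set (A @ B)"
    using assms AB by (auto simp: perms_iff)
  have set_AB: "set (A @ B) = {2..Suc n}"
  proof -
    have "set (A @ B) = set \<tau> - {1}" using AB dist by auto
    then show ?thesis using assms by (auto simp: perms_iff)
  qed
  define \<beta> where "\<beta> = map (\<lambda>x. x - 1) (A @ B)"
  have shift: "map Suc (map (\<lambda>x. x - 1) C) = C" if "set C \<subseteq> set (A @ B)" for C
  proof -
    have "Suc (x - 1) = x" if "x \<in> set C" for x
    proof -
      have "x \<in> {2..Suc n}" using that \<open>set C \<subseteq> set (A @ B)\<close> set_AB by blast
      then show ?thesis by simp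
    qed
    then show ?thesis by (simp add: map_idI)
  qed
  have "inj_on (\<lambda>x. x - 1) {2..Suc n}" by (auto simp: inj_on_def)
  moreover have "(\<lambda>x. x - 1) ` {2..Suc n} = {1..n}"
  proof (intro equalityI subsetI)
    fix v assume "v \<in> {1..n}"
    then show "v \<in> (\<lambda>x. x - 1) ` {2..Suc n}"
      by (intro image_eqI[of _ _ "Suc v"]) auto
  qed auto
  ultimately have "\<beta> \<in> perms n"
    using dist set_AB by (simp add: perms_iff \<beta>_def distinct_map del: map_append set_append)
  moreover have "\<tau> = insert_one (length A) \<beta>"
    using AB shift[of A] shift[of B] by (simp add: insert_one_def \<beta>_def)
  moreover have "length A \<le> n"
    using perms_length[OF assms] AB by simp
  ultimately show ?thesis using that by blast
qed

text \<open>All \<open>k\<close> letters in front of the inserted 1 exceed it, which gives the head.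
  Being the smallest letter, 1 is never counted for any other letter, which gives the tail.\<close>

lemma invcode_insert_one:
  assumes "\<beta> \<in> perms n" "k \<le> n"
  shows "invcode (insert_one k \<beta>) = k # invcode \<beta>"
proof -
  have pos: "0 \<notin> set \<beta>" using assms by (simp add: perms_iff)
  \<comment> \<open>As \<open>i\<close> is at least 1, the inserted 1 neither stops the scan for
    \<open>Suc i\<close> nor passes the filter.\<close>
  have shifted: "length (filter (\<lambda>v. v > Suc i) (takeWhile (\<lambda>v. v \<noteq> Suc i) (map Suc A @ 1 # map Suc B)))
      = length (filter (\<lambda>v. v > i) (takeWhile (\<lambda>v. v \<noteq> i) (A @ B)))" if "i \<ge> 1" for i A B
    using that
    by (induction A) (auto simp: takeWhile_map filter_map o_def)
  have "takeWhile (\<lambda>v. v \<noteq> 1) (map Suc (take k \<beta>) @ 1 # map Suc (drop k \<beta>)) = map Suc (take k \<beta>)"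
    using pos by (subst takeWhile_append2) (auto dest: in_set_takeD)
  moreover have "filter (\<lambda>v. v > 1) (map Suc (take k \<beta>)) = map Suc (take k \<beta>)"
    using pos by (auto simp: filter_id_conv dest!: in_set_takeD intro!: gr0I)
  ultimately have first: "length (filter (\<lambda>v. v > 1) (takeWhile (\<lambda>v. v \<noteq> 1) (insert_one k \<beta>))) = k"
    using assms perms_length[OF assms(1)] by (simp add: insert_one_def)
  have "[1..<Suc (Suc n)] = 1 # map Suc [1..<Suc n]"
    by (simp add: upt_conv_Cons map_Suc_upt del: upt_Suc)
  then have "invcode (insert_one k \<beta>) = k # map (\<lambda>i. length (filter (\<lambda>v. v > Suc i)
      (takeWhile (\<lambda>v. v \<noteq> Suc i) (insert_one k \<beta>)))) [1..<Suc n]"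
    using first perms_length[OF insert_one_perms[OF assms(1), of k]]
    by (simp add: invcode_def o_def del: upt_Suc)
  also have "map (\<lambda>i. length (filter (\<lambda>v. v > Suc i)
      (takeWhile (\<lambda>v. v \<noteq> Suc i) (insert_one k \<beta>)))) [1..<Suc n] = invcode \<beta>"
    unfolding invcode_def perms_length[OF assms(1)]
  proof (rule map_cong[OF refl])
    fix i assume "i \<in> set [1..<Suc n]"
    then show "length (filter (\<lambda>v. v > Suc i) (takeWhile (\<lambda>v. v \<noteq> Suc i) (insert_one k \<beta>)))
      = length (filter (\<lambda>v. v > i) (takeWhile (\<lambda>v. v \<noteq> i) \<beta>))"
      using shifted[of i "take k \<beta>" "drop k \<beta>"] by (auto simp: insert_one_def simp del: upt_Suc)
  qed
  finally show ?thesis .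
qed

text \<open>Inverse of \<open>invcode\<close> on sub-diagonal sequences. The head is the position of
  the last insertion.\<close>

fun decode :: "nat list \<Rightarrow> nat list" where
  "decode [] = []"
| "decode (k # c) = insert_one k (decode c)"

lemma decode_perms: "c \<in> subdiagonal n \<Longrightarrow> decode c \<in> perms n"
proof (induction n arbitrary: c)
  case (Suc n)
  then show ?case by (auto elim!: subdiagonal_SucE intro!: insert_one_perms)
qed (simp add: perms_iff)

lemma invcode_decode: "c \<in> subdiagonal n \<Longrightarrow> invcode (decode c) = c"
proof (induction n arbitrary: c)
  case (Suc n)
  obtain k d where "c = k # d" "k \<le> n" "d \<in> subdiagonal n"
    using Suc.prems by (rule subdiagonal_SucE)
  then show ?case using Suc.IH invcode_insert_one[OF decode_perms] by simp
qed (simp add: invcode_def)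

lemma decode_surj: "\<tau> \<in> perms n \<Longrightarrow> \<exists>c\<in>subdiagonal n. decode c = \<tau>"
proof (induction n arbitrary: \<tau>)
  case (Suc n)
  obtain k \<beta> where "k \<le> n" "\<beta> \<in> perms n" "\<tau> = insert_one k \<beta>"
    using Suc.prems by (rule perms_SucE)
  moreover obtain c where "c \<in> subdiagonal n" "decode c = \<beta>"
    using Suc.IH calculation by blast
  ultimately show ?case by (intro bexI[of _ "k # c"]) auto
qed (simp add: perms_iff)

lemma bij_betw_decode: "bij_betw decode (subdiagonal n) (perms n)"
  unfolding bij_betw_def
proof
  show "inj_on decode (subdiagonal n)"
    by (rule inj_on_inverseI) (rule invcode_decode)
  show "decode ` subdiagonal n = perms n"
    using decode_perms decode_surj by blast
qed

section \<open>Inverse permutations and their descents\<close>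

lemma word_inverse_length [simp]: "length (word_inverse \<sigma>) = length \<sigma>"
  by (simp add: word_inverse_def del: upt_Suc)

lemma word_inverse_nth:
  assumes "\<sigma> \<in> perms n" "j < n"
  shows "word_inverse \<sigma> ! (\<sigma> ! j - 1) = Suc j"
proof -
  have n: "length \<sigma> = n" by (rule perms_length[OF assms(1)])
  have "\<sigma> ! j \<in> {1..n}" using assms n nth_mem[of j \<sigma>] by (simp add: perms_iff)
  moreover have "inj_on (\<lambda>j. \<sigma> ! j) {..<n}"
    using assms n by (auto simp: perms_iff inj_on_def nth_eq_iff_index_eq)
  then have "inv_into {..<n} (\<lambda>j. \<sigma> ! j) (\<sigma> ! j) = j"
    using inv_into_f_f[of "\<lambda>j. \<sigma> ! j" "{..<n}" j] assms by simp
  ultimately show ?thesis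
    using n by (auto simp: word_inverse_def nth_append simp del: upt_Suc)
qed

text \<open>The indices \<open>\<sigma> ! j - 1\<close> exhaust all positions of \<open>w\<close>.
  Later proofs thus compute inverses without \<open>inv_into\<close>.\<close>

lemma word_inverse_eqI:
  assumes "\<sigma> \<in> perms n" "length w = n"
    and "\<And>j. j < n \<Longrightarrow> w ! (\<sigma> ! j - 1) = Suc j"
  shows "word_inverse \<sigma> = w"
proof (rule nth_equalityI)
  show "length (word_inverse \<sigma>) = length w"
    using assms perms_length by simp
  fix v assume "v < length (word_inverse \<sigma>)"
  then have "v < n" using perms_length[OF assms(1)] by simp
  then have "Suc v \<in> set \<sigma>" using assms(1) by (simp add: perms_iff)
  then obtain j where "j < n" "\<sigma> ! j = Suc v"
    using perms_length[OF assms(1)] by (auto simp: in_set_conv_nth)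
  then show "word_inverse \<sigma> ! v = w ! v"
    using word_inverse_nth[OF assms(1)] assms(3) by force
qed

text \<open>The inverse takes every value in \<open>{1..n}\<close>, and a word of length
  \<open>n\<close> doing so has no repeated letter.\<close>

lemma word_inverse_perms:
  assumes "\<sigma> \<in> perms n"
  shows "word_inverse \<sigma> \<in> perms n"
proof -
  have n: "length \<sigma> = n" by (rule perms_length[OF assms])
  have "{1..n} \<subseteq> set (word_inverse \<sigma>)"
  proof
    fix v assume v: "v \<in> {1..n}"
    then have *: "v - 1 < n" by auto
    then have "\<sigma> ! (v - 1) \<in> {1..n}"
      using assms n nth_mem[of "v - 1" \<sigma>] by (simp add: perms_iff)
    then have "\<sigma> ! (v - 1) - 1 < length (word_inverse \<sigma>)" using n by auto
    then show "v \<in> set (word_inverse \<sigma>)"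
      using word_inverse_nth[OF assms *] v nth_mem[of "\<sigma> ! (v - 1) - 1" "word_inverse \<sigma>"] by simp
  qed
  moreover have "card (set (word_inverse \<sigma>)) \<le> n"
    using card_length[of "word_inverse \<sigma>"] n by simp
  ultimately have "set (word_inverse \<sigma>) = {1..n}"
    using card_seteq[of "set (word_inverse \<sigma>)" "{1..n}"] by simp
  then show ?thesis
    using n by (simp add: perms_iff card_distinct)
qed

lemma word_inverse_involutive:
  assumes "\<sigma> \<in> perms n"
  shows "word_inverse (word_inverse \<sigma>) = \<sigma>"
proof (rule word_inverse_eqI[OF word_inverse_perms[OF assms] perms_length[OF assms]])
  fix j assume j: "j < n"
  then have "Suc j \<in> set \<sigma>" using assms by (simp add: perms_iff)
  then obtain i where "i < n" "\<sigma> ! i = Suc j"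
    using perms_length[OF assms] by (auto simp: in_set_conv_nth)
  then show "\<sigma> ! (word_inverse \<sigma> ! j - 1) = Suc j"
    using word_inverse_nth[OF assms, of i] by simp
qed

lemma bij_betw_word_inverse: "bij_betw word_inverse (perms n) (perms n)"
  by (rule bij_betw_byWitness[of _ word_inverse])
    (auto simp: word_inverse_involutive word_inverse_perms)

text \<open>The entries of the inverse are 1-based positions: the letter 1 now sits at
  \<open>Suc k\<close>, and exactly the letters formerly at positions above \<open>k\<close> move
  one place to the right.\<close>

lemma word_inverse_insert_one:
  assumes "\<beta> \<in> perms n" "k \<le> n"
  shows "word_inverse (insert_one k \<beta>) =
    Suc k # map (\<lambda>p. if p \<le> k then p else Suc p) (word_inverse \<beta>)"
proof (rule word_inverse_eqI[OF insert_one_perms[OF assms(1)]])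
  have n: "length \<beta> = n" by (rule perms_length[OF assms(1)])
  then show "length (Suc k # map (\<lambda>p. if p \<le> k then p else Suc p) (word_inverse \<beta>)) = Suc n"
    by simp
  have letter: "\<exists>v. \<beta> ! i = Suc v \<and> v < n \<and> word_inverse \<beta> ! v = Suc i" if "i < n" for i
  proof -
    have "\<beta> ! i \<in> {1..n}" using assms n that nth_mem[of i \<beta>] by (simp add: perms_iff)
    then show ?thesis
      using word_inverse_nth[OF assms(1) that] by (intro exI[of _ "\<beta> ! i - 1"]) auto
  qed
  fix j assume j: "j < Suc n"
  consider "j < k" | "j = k" | "k < j" by linarith
  then show "(Suc k # map (\<lambda>p. if p \<le> k then p else Suc p) (word_inverse \<beta>)) !
      (insert_one k \<beta> ! j - 1) = Suc j"
  proof cases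
    case 1
    then show ?thesis using letter[of j] assms n j by (auto simp: insert_one_def nth_append)
  next
    case 2
    then show ?thesis using assms n by (simp add: insert_one_def nth_append)
  next
    case 3
    then obtain i where i: "j = Suc i" "k \<le> i" by (cases j) auto
    then have "insert_one k \<beta> ! j = Suc (\<beta> ! i)"
      using assms n j by (simp add: insert_one_def nth_append Suc_diff_le)
    then show ?thesis using letter[of i] i n j by auto
  qed
qed

text \<open>The shift \<open>sh\<close> is strictly increasing and so preserves the descents of the
  tail. The new head \<open>Suc k\<close> compares with the next entry \<open>sh (Suc i)\<close> as
  \<open>k\<close> compares with \<open>i\<close>.\<close>

lemma descent_set_word_inverse_decode:
  "c \<in> subdiagonal n \<Longrightarrow> descent_set (word_inverse (decode c)) = descent_set c"
proof (induction n arbitrary: c)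
  case (Suc n)
  obtain k c' where c: "c = k # c'" "k \<le> n" "c' \<in> subdiagonal n"
    using Suc.prems by (rule subdiagonal_SucE)
  define sh where "sh = (\<lambda>p. if p \<le> k then p else Suc p)"
  have w: "word_inverse (decode c) = Suc k # map sh (word_inverse (decode c'))"
    using c word_inverse_insert_one[OF decode_perms] by (simp add: sh_def)
  have "strict_mono sh" by (auto simp: strict_mono_def sh_def)
  then have tail: "descent_set (map sh (word_inverse (decode c'))) = descent_set c'"
    using Suc.IH c by (simp add: descent_set_map_strict_mono)
  show ?case
  proof (cases n)
    case 0
    then show ?thesis using c w by (simp add: word_inverse_def)
  next
    case (Suc m)
    obtain i c'' where c': "c' = i # c''" "i \<le> m" "c'' \<in> subdiagonal m"
      using c(3) unfolding Suc by (rule subdiagonal_SucE)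
    obtain w' where w': "word_inverse (decode c') = Suc i # w'"
      using c' word_inverse_insert_one[OF decode_perms] by simp
    have "sh (Suc i) < Suc k \<longleftrightarrow> i < k" by (auto simp: sh_def)
    then show ?thesis using c w w' c' tail by simp
  qed
qed (simp add: word_inverse_def)

text \<open>These are the invcodes of the inverses of the members of
  \<open>descent_class I\<close>.\<close>

definition ribbon_codes :: "nat list \<Rightarrow> nat list set" where
  "ribbon_codes I = {c \<in> subdiagonal (sum_list I). descent_set c = cut_points I}"

lemma bij_betw_descent_class:
  "bij_betw (\<lambda>c. word_inverse (decode c)) (ribbon_codes I) (descent_class I)"
proof -
  let ?n = "sum_list I"
  have bij: "bij_betw (\<lambda>c. word_inverse (decode c)) (subdiagonal ?n) (perms ?n)"
    using bij_betw_trans[OF bij_betw_decode bij_betw_word_inverse] by (simp add: o_def)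
  show ?thesis
    unfolding ribbon_codes_def descent_class_def cut_points_def[symmetric]
    by (rule bij_betw_Collect[OF bij]) (simp add: descent_set_word_inverse_decode)
qed

lemma sum_descent_class:
  "(\<Sum>\<sigma>\<in>descent_class I. f (word_inverse \<sigma>)) = (\<Sum>c\<in>ribbon_codes I. f (decode c))"
proof -
  have "(\<Sum>\<sigma>\<in>descent_class I. f (word_inverse \<sigma>)) =
      (\<Sum>c\<in>ribbon_codes I. f (word_inverse (word_inverse (decode c))))"
    by (rule sum.reindex_bij_betw[OF bij_betw_descent_class, symmetric])
  also have "\<dots> = (\<Sum>c\<in>ribbon_codes I. f (decode c))"
    by (rule sum.cong) (auto simp: ribbon_codes_def word_inverse_involutive[OF decode_perms])
  finally show ?thesis .
qed


section \<open>Complete homogeneous polynomials over a set of variables\<close>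

definition hom_sym :: "nat \<Rightarrow> nat set \<Rightarrow> xpoly" where
  "hom_sym k A = (\<Sum>M\<in>multisets_of_size A k. \<Prod>i\<in>#M. xvar i)"

lemma complete_hom_eq_hom_sym: "complete_hom k m = hom_sym k {0..m}"
  by (simp add: complete_hom_def hom_sym_def)

lemma hom_sym_0 [simp]: "hom_sym 0 A = 1"
  by (simp add: hom_sym_def)

lemma hom_sym_empty [simp]: "hom_sym (Suc k) {} = 0"
  by (simp add: hom_sym_def)

text \<open>Multisets are split by whether \<open>x\<close> occurs; if so, one copy of
  \<open>x\<close> is taken out and further copies may remain.\<close>

lemma hom_sym_insert:
  assumes "finite A" "x \<notin> A"
  shows "hom_sym (Suc k) (insert x A) = hom_sym (Suc k) A + xvar x * hom_sym k (insert x A)"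
proof -
  have split: "multisets_of_size (insert x A) (Suc k) =
      multisets_of_size A (Suc k) \<union> add_mset x ` multisets_of_size (insert x A) k"
  proof (intro equalityI subsetI)
    fix M assume M: "M \<in> multisets_of_size (insert x A) (Suc k)"
    show "M \<in> multisets_of_size A (Suc k) \<union> add_mset x ` multisets_of_size (insert x A) k"
    proof (cases "x \<in># M")
      case True
      then obtain N where "M = add_mset x N" by (meson mset_add)
      then show ?thesis using M by (auto simp: multisets_of_size_def)
    next
      case False
      then show ?thesis using M by (auto simp: multisets_of_size_def)
    qed
  qed (auto simp: multisets_of_size_def)
  have "multisets_of_size A (Suc k) \<inter> add_mset x ` multisets_of_size (insert x A) k = {}"
    using assms(2) by (auto simp: multisets_of_size_def)
  moreover have "(\<Sum>M\<in>add_mset x ` multisets_of_size (insert x A) k. \<Prod>i\<in>#M. xvar i) =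
      xvar x * hom_sym k (insert x A)"
    by (subst sum.reindex) (auto simp: hom_sym_def sum_distrib_left inj_on_def)
  ultimately show ?thesis
    unfolding hom_sym_def split using assms
    by (subst sum.union_disjoint) (auto simp: finite_multisets_of_size hom_sym_def)
qed

text \<open>Monomials are grouped by the largest index \<open>i\<close> for which the variable
  \<open>a i\<close> occurs, and one copy of that variable is taken out.\<close>

lemma hom_sym_prefix_sum:
  fixes a :: "nat \<Rightarrow> nat"
  assumes "inj_on a {0..j}"
  shows "hom_sym (Suc k) (a ` {0..j}) = (\<Sum>i=0..j. xvar (a i) * hom_sym k (a ` {0..i}))"
  using assms
proof (induction j)
  case 0
  then show ?case using hom_sym_insert[of "{}" "a 0" k] by simp
next
  case (Suc j)
  have "a (Suc j) \<notin> a ` {0..j}" using Suc.prems by (force simp: inj_on_def)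
  moreover have "a ` {0..Suc j} = insert (a (Suc j)) (a ` {0..j})"
    by (auto simp: atLeast0_atMost_Suc)
  moreover have "inj_on a {0..j}" using Suc.prems by (auto simp: inj_on_def)
  ultimately show ?case using Suc.IH by (simp add: hom_sym_insert)
qed

section \<open>Prefixing nondecreasing sequences\<close>

definition sorted_lists :: "nat \<Rightarrow> nat \<Rightarrow> nat list set" where
  "sorted_lists a j = {d. length d = a \<and> sorted d \<and> set d \<subseteq> {0..j}}"

lemma finite_sorted_lists [simp]: "finite (sorted_lists a j)"
  by (rule finite_subset[OF _ finite_lists_length_eq[of "{0..j}" a]]) (auto simp: sorted_lists_def)

lemma sorted_lists_0 [simp]: "sorted_lists 0 j = {[]}"
  by (auto simp: sorted_lists_def)

text \<open>The last entry is the greatest and bounds all the others. In \<open>d @ c\<close> it is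
  also the first of the prefix to be inserted, so it can be absorbed into \<open>c\<close>.\<close>

lemma bij_betw_sorted_lists_snoc:
  "bij_betw (\<lambda>(i, d). d @ [i]) (SIGMA i:{0..j}. sorted_lists a i) (sorted_lists (Suc a) j)"
proof (rule bij_betw_byWitness[where f' = "\<lambda>d. (last d, butlast d)"])
  show "\<forall>d\<in>sorted_lists (Suc a) j. (case (last d, butlast d) of (i, d) \<Rightarrow> d @ [i]) = d"
    by (auto simp: sorted_lists_def intro!: append_butlast_last_id)
  show "(\<lambda>d. (last d, butlast d)) ` sorted_lists (Suc a) j \<subseteq> (SIGMA i:{0..j}. sorted_lists a i)"
  proof (rule image_subsetI)
    fix d assume d: "d \<in> sorted_lists (Suc a) j"
    then have "d \<noteq> []" by (auto simp: sorted_lists_def)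
    then obtain e i where "d = e @ [i]" by (metis append_butlast_last_id)
    then show "(last d, butlast d) \<in> (SIGMA i:{0..j}. sorted_lists a i)"
      using d by (auto simp: sorted_lists_def sorted_append)
  qed
qed (force simp: sorted_lists_def sorted_append)+

text \<open>The two ribbons together leave open whether \<open>a\<close> is a descent, so the prefix
  of length \<open>a\<close> and the remaining code can be chosen independently.\<close>

lemma bij_betw_sorted_lists_append:
  assumes "a \<ge> 1" "\<forall>i\<in>set (b # J). 1 \<le> i"
  shows "bij_betw (\<lambda>(d, c). d @ c)
    (sorted_lists a (sum_list (b # J)) \<times> ribbon_codes (b # J))
    (ribbon_codes (a # b # J) \<union> ribbon_codes ((a + b) # J))"
proof (rule bij_betw_byWitness[where f' = "\<lambda>e. (take a e, drop a e)"])
  let ?m = "sum_list (b # J)"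
  have a_notin: "a \<notin> (+) a ` cut_points (b # J)"
    using cut_points_positive[OF assms(2)] by auto
  have cut: "cut_points (a # b # J) = insert a ((+) a ` cut_points (b # J))"
    by (simp add: cut_points_Cons)
  show "\<forall>e\<in>sorted_lists a ?m \<times> ribbon_codes (b # J).
      (take a (case e of (d, c) \<Rightarrow> d @ c), drop a (case e of (d, c) \<Rightarrow> d @ c)) = e"
    by (auto simp: sorted_lists_def)
  show "(\<lambda>(d, c). d @ c) ` (sorted_lists a ?m \<times> ribbon_codes (b # J)) \<subseteq>
      ribbon_codes (a # b # J) \<union> ribbon_codes ((a + b) # J)"
  proof (rule image_subsetI, clarify)
    fix d c assume d: "d \<in> sorted_lists a ?m" and c: "c \<in> ribbon_codes (b # J)"
    assume no: "d @ c \<notin> ribbon_codes ((a + b) # J)"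
    have sub: "d @ c \<in> subdiagonal (a + ?m)"
      using subdiagonal_append[of c ?m d] c d by (auto simp: sorted_lists_def ribbon_codes_def)
    have "c \<noteq> []" using c assms(2) by (auto simp: ribbon_codes_def dest: subdiagonal_length)
    then have "descent_set (d @ c) - {a} = (+) a ` cut_points (b # J)"
      using descent_set_append[of c d] c d
      by (auto simp: sorted_lists_def ribbon_codes_def sorted_iff_descent_set_empty)
    \<comment> \<open>Only position \<open>a\<close> is undetermined: without it the merged
      composition results, with it \<open>a # b # J\<close>.\<close>
    then have "descent_set (d @ c) = (+) a ` cut_points (b # J) \<or>
        descent_set (d @ c) = insert a ((+) a ` cut_points (b # J))"
      by blast
    then show "d @ c \<in> ribbon_codes (a # b # J)"
      using no sub by (auto simp: ribbon_codes_def cut cut_points_merge add.assoc)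
  qed
  have main: "take a e \<in> sorted_lists a ?m \<and> drop a e \<in> ribbon_codes (b # J)"
    if "e \<in> ribbon_codes (a # b # J) \<union> ribbon_codes ((a + b) # J)" for e
  proof -
    define d c where "d = take a e" and "c = drop a e"
    have e: "e = d @ c" by (simp add: d_def c_def)
    have sub: "e \<in> subdiagonal (a + ?m)"
      using that by (auto simp: ribbon_codes_def add.assoc)
    have len: "length d = a" "length c = ?m"
      using subdiagonal_length[OF sub] by (auto simp: d_def c_def)
    have "c \<noteq> []" using len assms(2) by auto
    moreover have "descent_set e - {a} = (+) a ` cut_points (b # J)"
      using that a_notin by (auto simp: ribbon_codes_def cut cut_points_merge)
    ultimately have des: "descent_set d \<union> (+) a ` descent_set c = (+) a ` cut_points (b # J)"
      using descent_set_append[of c d] e len by simp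
    \<comment> \<open>Descents of \<open>d\<close> lie strictly below \<open>a\<close>, whereas
      shifted cut points are at least \<open>a\<close>.\<close>
    have "descent_set d = {}"
    proof (rule equals0I)
      fix j assume j: "j \<in> descent_set d"
      then have "j \<in> (+) a ` cut_points (b # J)" using des by blast
      then show False using descent_set_bounds[OF j] len by auto
    qed
    then have "sorted d" and "(+) a ` descent_set c = (+) a ` cut_points (b # J)"
      using des by (auto simp: sorted_iff_descent_set_empty)
    then show ?thesis
      using subdiagonal_append_sortedD[of d c ?m] sub len e
      by (simp add: d_def[symmetric] c_def[symmetric] sorted_lists_def ribbon_codes_def
          inj_image_eq_iff)
  qed
  then show "(\<lambda>e. (take a e, drop a e)) ` (ribbon_codes (a # b # J) \<union> ribbon_codes ((a + b) # J))
      \<subseteq> sorted_lists a ?m \<times> ribbon_codes (b # J)"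
    by blast
qed simp

lemma ribbon_codes_disjoint:
  assumes "\<forall>i\<in>set (b # J). 1 \<le> i"
  shows "ribbon_codes (a # b # J) \<inter> ribbon_codes ((a + b) # J) = {}"
proof -
  have "a \<notin> (+) a ` cut_points (b # J)"
    using cut_points_positive[OF assms] by auto
  then show ?thesis
    by (auto simp: ribbon_codes_def cut_points_Cons[of "b # J"] cut_points_merge)
qed

lemma finite_ribbon_codes [simp]: "finite (ribbon_codes I)"
  by (simp add: ribbon_codes_def)

text \<open>A sub-diagonal sequence ends in 0, so a nondecreasing one is constantly 0.\<close>

lemma ribbon_codes_singleton: "ribbon_codes [a] = sorted_lists a 0"
proof (intro equalityI subsetI)
  fix c assume "c \<in> ribbon_codes [a]"
  then have "c \<in> subdiagonal a" "sorted c"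
    by (auto simp: ribbon_codes_def sorted_iff_descent_set_empty)
  then show "c \<in> sorted_lists a 0"
    using subdiagonal_append_sortedD[of c "[]" 0] subdiagonal_length[of c a]
    by (simp add: sorted_lists_def)
next
  fix c assume "c \<in> sorted_lists a 0"
  then show "c \<in> ribbon_codes [a]"
    using subdiagonal_append[of "[]" 0 c]
    by (auto simp: sorted_lists_def ribbon_codes_def sorted_iff_descent_set_empty)
qed

section \<open>Generating functions of labelled insertions\<close>

text \<open>The value \<open>t c k\<close> abstracts \<open>\<tau>\<^sub>G(decode c)(k)\<close>.\<close>

locale insertion_labelling =
  fixes t :: "nat list \<Rightarrow> nat \<Rightarrow> nat"
  assumes bij: "c \<in> subdiagonal m \<Longrightarrow> bij_betw (t c) {0..m} {0..m}"
    and prefix: "c \<in> subdiagonal m \<Longrightarrow> k \<le> m \<Longrightarrow> t (k # c) ` {0..k} = t c ` {0..k}"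
begin

text \<open>For \<open>t\<close> obtained from an acceptable code \<open>Gc\<close> this is
  \<open>Gc (decode c)\<close>; for the identity labelling it is \<open>c\<close> itself.\<close>

fun labels :: "nat list \<Rightarrow> nat list" where
  "labels [] = []"
| "labels (k # c) = t c k # labels c"

text \<open>Induction on \<open>a\<close>, splitting off the last prefix entry \<open>i\<close>. A
  general bound \<open>j\<close> is needed because the remaining prefix is bounded by
  \<open>i\<close>, although \<open>i # c\<close> has length \<open>Suc m\<close>.\<close>

lemma sum_labels_sorted_lists:
  assumes "c \<in> subdiagonal m" "j \<le> m"
  shows "(\<Sum>d\<in>sorted_lists a j. xmonom (labels (d @ c))) =
    hom_sym a (t c ` {0..j}) * xmonom (labels c)"
  using assms
proof (induction a arbitrary: c m j)
  case (Suc a)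
  have "(\<Sum>d\<in>sorted_lists (Suc a) j. xmonom (labels (d @ c))) =
      (\<Sum>(i, d)\<in>(SIGMA i:{0..j}. sorted_lists a i). xmonom (labels (d @ i # c)))"
    by (subst sum.reindex_bij_betw[OF bij_betw_sorted_lists_snoc, symmetric])
      (simp add: case_prod_unfold)
  also have "\<dots> = (\<Sum>i=0..j. \<Sum>d\<in>sorted_lists a i. xmonom (labels (d @ i # c)))"
    by (rule sum.Sigma[symmetric]) auto
  also have "\<dots> = (\<Sum>i=0..j. hom_sym a (t c ` {0..i}) * (xvar (t c i) * xmonom (labels c)))"
  proof (rule sum.cong[OF refl])
    fix i assume "i \<in> {0..j}"
    then have i: "i \<le> m" using Suc.prems by simp
    have "(\<Sum>d\<in>sorted_lists a i. xmonom (labels (d @ i # c))) =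
        hom_sym a (t (i # c) ` {0..i}) * xmonom (labels (i # c))"
      by (rule Suc.IH[of "i # c" "Suc m" i]) (use i Suc.prems in auto)
    \<comment> \<open>Acceptability enters here: \<open>prefix\<close> replaces the variables given
      by \<open>t (i # c)\<close> by those given by \<open>t c\<close>.\<close>
    then show "(\<Sum>d\<in>sorted_lists a i. xmonom (labels (d @ i # c))) =
        hom_sym a (t c ` {0..i}) * (xvar (t c i) * xmonom (labels c))"
      using prefix[OF Suc.prems(1) i] by (simp add: xmonom_def)
  qed
  also have "\<dots> = (\<Sum>i=0..j. xvar (t c i) * hom_sym a (t c ` {0..i})) * xmonom (labels c)"
    unfolding sum_distrib_right by (rule sum.cong) (simp_all only: mult_ac)
  \<comment> \<open>Injectivity is not a link of the chain; it only feeds the next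
    \<open>note\<close>, whose equation is what \<open>finally\<close> uses to rewrite the
    sum.\<close>
  also have "inj_on (t c) {0..j}"
    using bij[OF Suc.prems(1)] Suc.prems(2) by (auto simp: bij_betw_def intro: inj_on_subset)
  note hom_sym_prefix_sum[OF this, of a, symmetric]
  finally show ?case .
qed simp

lemma sum_labels_full:
  assumes "c \<in> subdiagonal m"
  shows "(\<Sum>d\<in>sorted_lists a m. xmonom (labels (d @ c))) = complete_hom a m * xmonom (labels c)"
  using sum_labels_sorted_lists[OF assms order_refl] bij[OF assms]
  by (simp add: complete_hom_eq_hom_sym bij_betw_def)

lemma sum_labels_recurrence:
  assumes "a \<ge> 1" "\<forall>i\<in>set (b # J). 1 \<le> i"
  shows "(\<Sum>c\<in>ribbon_codes (a # b # J). xmonom (labels c)) +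
    (\<Sum>c\<in>ribbon_codes ((a + b) # J). xmonom (labels c)) =
    complete_hom a (sum_list (b # J)) * (\<Sum>c\<in>ribbon_codes (b # J). xmonom (labels c))"
proof -
  let ?m = "sum_list (b # J)"
  have "(\<Sum>c\<in>ribbon_codes (a # b # J). xmonom (labels c)) +
      (\<Sum>c\<in>ribbon_codes ((a + b) # J). xmonom (labels c)) =
      (\<Sum>c\<in>ribbon_codes (a # b # J) \<union> ribbon_codes ((a + b) # J). xmonom (labels c))"
    by (rule sum.union_disjoint[symmetric]) (use ribbon_codes_disjoint[OF assms(2)] in auto)
  also have "\<dots> = (\<Sum>(d, c)\<in>sorted_lists a ?m \<times> ribbon_codes (b # J). xmonom (labels (d @ c)))"
    by (subst sum.reindex_bij_betw[OF bij_betw_sorted_lists_append[OF assms], symmetric])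
      (simp add: case_prod_unfold)
  also have "\<dots> = (\<Sum>c\<in>ribbon_codes (b # J). \<Sum>d\<in>sorted_lists a ?m. xmonom (labels (d @ c)))"
    by (subst sum.cartesian_product[symmetric], rule sum.swap)
  also have "\<dots> = (\<Sum>c\<in>ribbon_codes (b # J). complete_hom a ?m * xmonom (labels c))"
    by (rule sum.cong[OF refl], rule sum_labels_full) (simp add: ribbon_codes_def)
  finally show ?thesis by (simp add: sum_distrib_left)
qed

end

section \<open>The ribbon determinant\<close>

lemma ribbon_poly_singleton: "ribbon_poly [a] = complete_hom a 0"
  unfolding ribbon_poly_def by (subst det_single) (auto simp: ribbon_matrix_def partial_sum_def)

text \<open>Expansion along the first column, where only the top entry and the 1 below it survive;
  their minors are the ribbon matrices of \<open>b # J\<close> and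
  \<open>(a + b) # J\<close>.\<close>

lemma ribbon_poly_recurrence:
  "ribbon_poly (a # b # J) =
    complete_hom a (sum_list (b # J)) * ribbon_poly (b # J) - ribbon_poly ((a + b) # J)"
proof -
  let ?r = "length J" and ?M = "ribbon_matrix (a # b # J)"
  have M: "?M \<in> carrier_mat (Suc (Suc ?r)) (Suc (Suc ?r))"
    by (simp add: ribbon_matrix_def)
  \<comment> \<open>The top row without its first entry has degrees starting at
    \<open>a + b\<close>, as for the merged composition.\<close>
  have initial: "(\<Sum>j=0..Suc q. (a # b # J) ! j) = (\<Sum>j=0..q. ((a + b) # J) ! j)" for q
    by (induction q) auto
  have delete0: "mat_delete ?M 0 0 = ribbon_matrix (b # J)"
    by (rule eq_matI) (auto simp: mat_delete_def ribbon_matrix_def sum.shift_bounds_cl_Suc_ivl partial_sum_def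
        simp del: sum.cl_ivl_Suc)
  have delete1: "mat_delete ?M 1 0 = ribbon_matrix ((a + b) # J)"
  proof (rule eq_matI)
    fix p q assume pq: "p < dim_row (ribbon_matrix ((a + b) # J))"
      "q < dim_col (ribbon_matrix ((a + b) # J))"
    show "mat_delete ?M 1 0 $$ (p, q) = ribbon_matrix ((a + b) # J) $$ (p, q)"
    proof (cases p)
      case 0
      then show ?thesis using pq
        by (simp add: mat_delete_def ribbon_matrix_def initial partial_sum_def add.assoc
            del: sum.cl_ivl_Suc)
    next
      case (Suc p')
      then show ?thesis using pq
        by (cases q) (auto simp: mat_delete_def ribbon_matrix_def sum.shift_bounds_cl_Suc_ivl partial_sum_def add.assoc
            simp del: sum.cl_ivl_Suc)
    qed
  qed (auto simp: mat_delete_def ribbon_matrix_def)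
  have "det ?M = (\<Sum>i<Suc (Suc ?r). ?M $$ (i, 0) * cofactor ?M i 0)"
    by (rule laplace_expansion_column[OF M]) simp
  also have "\<dots> = (\<Sum>i\<in>{0, 1}. ?M $$ (i, 0) * cofactor ?M i 0)"
    by (rule sum.mono_neutral_right) (auto simp: ribbon_matrix_def)
  also have "\<dots> = complete_hom a (sum_list (b # J)) * det (mat_delete ?M 0 0) - det (mat_delete ?M 1 0)"
    by (simp add: cofactor_def ribbon_matrix_def partial_sum_def)
  finally show ?thesis
    unfolding delete0 delete1 ribbon_poly_def .
qed

text \<open>Code sums and determinants satisfy the same recurrence, in which both
  \<open>b # J\<close> and \<open>(a + b) # J\<close> have one part fewer than
  \<open>a # b # J\<close>.\<close>

lemma (in insertion_labelling) sum_labels_ribbon_codes: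
  assumes "I \<noteq> []" "\<forall>i\<in>set I. 1 \<le> i"
  shows "(\<Sum>c\<in>ribbon_codes I. xmonom (labels c)) = ribbon_poly I"
  using assms
proof (induction "length I" arbitrary: I)
  case (Suc r)
  obtain a L where I: "I = a # L" using Suc.prems by (cases I) auto
  show ?case
  proof (cases L)
    case Nil
    then show ?thesis
      using sum_labels_full[of "[]" 0 a] I
      by (simp add: ribbon_codes_singleton ribbon_poly_singleton xmonom_def)
  next
    case (Cons b J)
    have "(\<Sum>c\<in>ribbon_codes (b # J). xmonom (labels c)) = ribbon_poly (b # J)"
      by (rule Suc.hyps(1)) (use Suc I Cons in auto)
    moreover have "(\<Sum>c\<in>ribbon_codes ((a + b) # J). xmonom (labels c)) = ribbon_poly ((a + b) # J)"
      by (rule Suc.hyps(1)) (use Suc I Cons in auto)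
    ultimately show ?thesis
      using sum_labels_recurrence[of a b J] Suc.prems I Cons
      by (simp add: ribbon_poly_recurrence algebra_simps)
  qed
qed simp

section \<open>Acceptable codes and the invcode\<close>

text \<open>By \<open>invcode_insert_one\<close>, the map \<open>tau\<close> of the invcode is the
  identity.\<close>

lemma insertion_labelling_invcode: "insertion_labelling (\<lambda>c k. k)"
  by unfold_locales (auto simp: bij_betw_def)

lemma labels_invcode: "insertion_labelling.labels (\<lambda>c k. k) c = c"
proof -
  interpret insertion_labelling "\<lambda>c k. k" by (rule insertion_labelling_invcode)
  show ?thesis by (induction c) auto
qed

lemma acceptable_code_Cons:
  assumes "acceptable_code Gc" "\<beta> \<in> perms n" "k \<le> n"
  shows "Gc (insert_one k \<beta>) = code_tau Gc \<beta> k # Gc \<beta>"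
proof -
  obtain u where "Gc (insert_one k \<beta>) = u # Gc \<beta>"
    using assms unfolding acceptable_code_def shuffle_compatible_def atLeastAtMost_iff Ball_def
    by blast
  then show ?thesis by (simp add: code_tau_def)
qed

text \<open>Equal labels give equal codes, hence equal words, and the insertion position is read off
  as the head of the invcode. An injective self-map of a finite set is bijective.\<close>

lemma acceptable_code_tau_bij:
  assumes "acceptable_code Gc" "\<beta> \<in> perms n"
  shows "bij_betw (code_tau Gc \<beta>) {0..n} {0..n}"
proof -
  have code: "bij_betw Gc (perms (Suc n)) (subdiagonal (Suc n))"
    using assms(1) by (auto simp: acceptable_code_def is_code_def)
  have "code_tau Gc \<beta> ` {0..n} \<subseteq> {0..n}"
  proof (rule image_subsetI)
    fix k assume "k \<in> {0..n}"
    then have "code_tau Gc \<beta> k # Gc \<beta> \<in> subdiagonal (Suc n)"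
      using acceptable_code_Cons[OF assms, of k] bij_betwE[OF code] insert_one_perms[OF assms(2), of k]
      by (metis atLeastAtMost_iff)
    then show "code_tau Gc \<beta> k \<in> {0..n}" by simp
  qed
  moreover have "inj_on (code_tau Gc \<beta>) {0..n}"
  proof (rule inj_onI)
    fix i k assume ik: "i \<in> {0..n}" "k \<in> {0..n}" "code_tau Gc \<beta> i = code_tau Gc \<beta> k"
    then have "Gc (insert_one i \<beta>) = Gc (insert_one k \<beta>)"
      using acceptable_code_Cons[OF assms] by simp
    then have "insert_one i \<beta> = insert_one k \<beta>"
      by (rule inj_onD[OF bij_betw_imp_inj_on[OF code]]) (intro insert_one_perms assms(2))+
    then have "invcode (insert_one i \<beta>) = invcode (insert_one k \<beta>)" by (rule arg_cong)
    then show "i = k"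
      using invcode_insert_one[OF assms(2)] ik(1,2) by simp
  qed
  ultimately show ?thesis
    by (simp add: bij_betw_def endo_inj_surj)
qed

lemma insertion_labelling_acceptable_code:
  assumes "acceptable_code Gc"
  shows "insertion_labelling (\<lambda>c. code_tau Gc (decode c))"
proof
  fix c m assume "c \<in> subdiagonal m"
  then show "bij_betw (code_tau Gc (decode c)) {0..m} {0..m}"
    by (intro acceptable_code_tau_bij[OF assms] decode_perms)
next
  fix c m and k :: nat assume "c \<in> subdiagonal m" "k \<le> m"
  then show "code_tau Gc (decode (k # c)) ` {0..k} = code_tau Gc (decode c) ` {0..k}"
    using assms decode_perms[of c m] by (simp add: acceptable_code_def)
qed

lemma labels_acceptable_code:
  assumes "acceptable_code Gc" "c \<in> subdiagonal n"
  shows "insertion_labelling.labels (\<lambda>c. code_tau Gc (decode c)) c = Gc (decode c)"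
proof -
  interpret insertion_labelling "\<lambda>c. code_tau Gc (decode c)"
    by (rule insertion_labelling_acceptable_code[OF assms(1)])
  show ?thesis
    using assms(2)
  proof (induction n arbitrary: c)
    \<comment> \<open>The empty word has an empty code because \<open>[]\<close> is the only
      sub-diagonal sequence of length 0.\<close>
    case 0
    have "bij_betw Gc (perms 0) (subdiagonal 0)"
      using assms(1) unfolding acceptable_code_def is_code_def by blast
    then have "Gc [] \<in> subdiagonal 0"
      by (rule bij_betw_apply) (simp add: perms_iff)
    then show ?case using 0 by simp
  next
    case (Suc n)
    obtain k d where "c = k # d" "k \<le> n" "d \<in> subdiagonal n"
      using Suc.prems by (rule subdiagonal_SucE)
    then show ?case
      using Suc.IH acceptable_code_Cons[OF assms(1) decode_perms] by simp
  qed
qed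

section \<open>Coefficients\<close>

definition exponents :: "nat list \<Rightarrow> nat \<Rightarrow>\<^sub>0 nat" where
  "exponents l = sum_list (map (\<lambda>i. Poly_Mapping.single i 1) l)"

lemma xmonom_eq_single: "xmonom l = Poly_Mapping.single (exponents l) 1"
  by (induction l) (auto simp: xmonom_def exponents_def xvar_def mult_single)

lemma lookup_exponents: "Poly_Mapping.lookup (exponents l) i = count (mset l) i"
  by (induction l) (auto simp: exponents_def lookup_add lookup_single when_def)

text \<open>A monomial records exactly the multiset of its indices, which the sorted list
  represents.\<close>

lemma exponents_eq_iff: "exponents l = exponents l' \<longleftrightarrow> sort l = sort l'"
proof
  assume "exponents l = exponents l'"
  then have "mset l = mset l'"
    by (intro multiset_eqI) (simp flip: lookup_exponents)
  then show "sort l = sort l'"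
    by (intro properties_for_sort) simp_all
next
  assume "sort l = sort l'"
  then have "mset l = mset l'" by (metis mset_sort)
  then show "exponents l = exponents l'"
    by (intro poly_mapping_eqI) (simp add: lookup_exponents)
qed

lemma lookup_sum_xmonom:
  assumes "finite A"
  shows "Poly_Mapping.lookup (\<Sum>x\<in>A. xmonom (f x)) (exponents c) =
    int (card {x \<in> A. sort (f x) = sort c})"
  using assms
  by (simp add: lookup_sum xmonom_eq_single lookup_single when_def exponents_eq_iff
      eq_commute[of "sort c"] flip: sum.inter_filter)

text \<open>For sorted \<open>c\<close> both cardinalities are the coefficient of the monomial of
  \<open>c\<close>; for any other \<open>c\<close> both sets are empty.\<close>

lemma card_sort_eq_if_sum_xmonom_eq:
  assumes "finite A" "(\<Sum>x\<in>A. xmonom (f x)) = (\<Sum>x\<in>A. xmonom (g x))"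
  shows "card {x \<in> A. sort (f x) = c} = card {x \<in> A. sort (g x) = c}"
proof (cases "sorted c")
  case True
  then have "sort c = c" by (simp add: sorted_sort_id)
  then show ?thesis
    using lookup_sum_xmonom[OF assms(1), of f c] lookup_sum_xmonom[OF assms(1), of g c] assms(2)
    by simp
next
  case False
  then have "sort (f x) \<noteq> c" "sort (g x) \<noteq> c" for x by auto
  then show ?thesis by simp
qed

theorem mainTheorem5:
  fixes Gc :: "nat list \<Rightarrow> nat list" and n :: nat and I :: "nat list"
  assumes "acceptable_code Gc"
    and "n \<ge> 1"
    and "composition_of I n"
  shows "(\<Sum>\<sigma>\<in>descent_class I. xmonom (Gc (word_inverse \<sigma>)))
           = (\<Sum>\<sigma>\<in>descent_class I. xmonom (invcode (word_inverse \<sigma>)))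
       \<and> (\<Sum>\<sigma>\<in>descent_class I. xmonom (invcode (word_inverse \<sigma>))) = ribbon_poly I
       \<and> (\<forall>c. card {\<sigma> \<in> descent_class I. sort (Gc (word_inverse \<sigma>)) = c}
             = card {\<sigma> \<in> descent_class I. sort (invcode (word_inverse \<sigma>)) = c})"
proof -
  have I: "I \<noteq> []" "\<forall>i\<in>set I. 1 \<le> i"
    using assms(2,3) by (auto simp: composition_of_def)
  have "(\<Sum>\<sigma>\<in>descent_class I. xmonom (Gc (word_inverse \<sigma>))) =
      (\<Sum>c\<in>ribbon_codes I. xmonom (insertion_labelling.labels (\<lambda>c. code_tau Gc (decode c)) c))"
    unfolding sum_descent_class[of "\<lambda>\<tau>. xmonom (Gc \<tau>)"]
    by (rule sum.cong) (auto simp: ribbon_codes_def labels_acceptable_code[OF assms(1)])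
  also have "\<dots> = ribbon_poly I"
    by (rule insertion_labelling.sum_labels_ribbon_codes
        [OF insertion_labelling_acceptable_code[OF assms(1)] I])
  finally have Gc: "(\<Sum>\<sigma>\<in>descent_class I. xmonom (Gc (word_inverse \<sigma>))) = ribbon_poly I" .
  have "(\<Sum>\<sigma>\<in>descent_class I. xmonom (invcode (word_inverse \<sigma>))) =
      (\<Sum>c\<in>ribbon_codes I. xmonom (insertion_labelling.labels (\<lambda>c k. k) c))"
    unfolding sum_descent_class[of "\<lambda>\<tau>. xmonom (invcode \<tau>)"]
    by (rule sum.cong) (auto simp: ribbon_codes_def labels_invcode invcode_decode)
  also have "\<dots> = ribbon_poly I"
    by (rule insertion_labelling.sum_labels_ribbon_codes[OF insertion_labelling_invcode I])
  finally have Ic: "(\<Sum>\<sigma>\<in>descent_class I. xmonom (invcode (word_inverse \<sigma>))) = ribbon_poly I" .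
  have "finite (descent_class I)"
    by (simp add: descent_class_def perms_def)
  from card_sort_eq_if_sum_xmonom_eq[OF this] Gc Ic show ?thesis by simp
qed

end
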